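(* Let $\hat\theta=\hat\theta_n\in\operatorname{argmin}_\theta f_n(\theta)$ and, for an initial estimator $\hat\theta_{init}$, let $\hat\theta_{ose}=\operatorname{prox}_{f_n}^{C_n}(\hat\theta_{init})$, where $f_n$ is such that both minimizers exist almost surely. Assume: (i) $\lambda_{\max}(C_n)=o_P(1)$; (ii) there is a constant $L$ such that for each constant $M$, the function $\operatorname{prox}_{f_n}^{C_n}$ is $L$-Lipschitz continuous on $\{\theta:\|\theta-\hat\theta\|\le M/\sqrt n\}$ with high probability; (iii) there is a constant $m>0$ such that for each constant $M$, the function $f_n$ is strongly convex with modulus $m$ on $\{\theta:\|\theta-\hat\theta\|\le M/\sqrt n\}$ with high probability. Then for any $\sqrt n$-consistent estimator $\hat\theta_{init}$ of $\hat\theta$, $\hat\theta$ and $\hat\theta_{ose}$ are asymptotically equivalent.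
   Context: $\Theta\subseteq\mathbb{R}^d$ is open; $f_n:\Omega\times\Theta\to\mathbb{R}\cup\{\infty\}$ is a sequence of random functions on a probability space $(\Omega,\mathcal A,P)$ (dependence on $\Omega$ suppressed), regarded as functions on $\mathbb{R}^d$ with value $+\infty$ outside $\Theta$; $C_n$ is a sequence of random (symmetric) positive definite $d\times d$ matrices, with $\lambda_{\max}(C_n)$ the largest eigenvalue. Estimators are random vectors depending on $n$. For $f:\mathbb{R}^d\to\mathbb{R}\cup\{\infty\}$ and positive definite $C$, the scaled proximal operator is $$\operatorname{prox}_f^C(x)=\operatorname{argmin}_{w\in\mathbb{R}^d}\Big\{f(w)+\tfrac12\|w-x\|_C^2\Big\},\qquad \|x\|_C^2=\langle x,Cx\rangle .$$ Saying that it is Lipschitz continuous on a set includes that it is single-valued there. An event depending on $n$ holds with high probability if for every $\epsilon>0$ its probability is at least $1-\epsilon$ for all sufficiently large $n$. $\hat\theta_{init}$ is $\sqrt n$-consistent for $\hat\theta$ if $\sqrt n(\hat\theta_{init}-\hat\theta)=O_P(1)$. Two estimators $\hat\theta,\tilde\theta$ are asymptotically equivalent if $\sqrt n\|\hat\theta-\tilde\theta\|=o_P(1)$. *)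

theory Defs
  imports "HOL-Probability.Probability"
begin

definition positive_definite :: "real^'d^'d \<Rightarrow> bool" where
  "positive_definite C \<longleftrightarrow> transpose C = C \<and> (\<forall>x. x \<noteq> 0 \<longrightarrow> 0 < x \<bullet> (C *v x))"

text \<open>For a symmetric matrix the set of real eigenvalues is finite and nonempty, so that
  \<^const>\<open>Max\<close> is meaningful; \<open>lambda_max\<close> is only used for such matrices.\<close>

definition lambda_max :: "real^'d^'d \<Rightarrow> real" where
  "lambda_max C = Max {k. \<exists>v. v \<noteq> 0 \<and> C *v v = k *\<^sub>R v}"

definition sq_norm_wrt :: "real^'d^'d \<Rightarrow> real^'d \<Rightarrow> real" where
  "sq_norm_wrt C x = x \<bullet> (C *v x)"

definition argmin :: "('a \<Rightarrow> ereal) \<Rightarrow> 'a set" where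
  "argmin f = {w. is_arg_min f (\<lambda>_. True) w}"

text \<open>The proximal operator is set-valued; nothing is presupposed about existence or uniqueness
  of the minimizer.\<close>

definition scaled_prox :: "real^'d^'d \<Rightarrow> (real^'d \<Rightarrow> ereal) \<Rightarrow> real^'d \<Rightarrow> (real^'d) set" where
  "scaled_prox C f x = argmin (\<lambda>w. f w + ereal (1 / 2 * sq_norm_wrt C (w - x)))"

definition single_valued_lipschitz_on ::
    "real \<Rightarrow> 'a::metric_space set \<Rightarrow> ('a \<Rightarrow> 'b::metric_space set) \<Rightarrow> bool" where
  "single_valued_lipschitz_on L S F \<longleftrightarrow>
     (\<exists>p. (\<forall>x\<in>S. F x = {p x}) \<and> L-lipschitz_on S p)"

text \<open>Functions with values in \<open>\<real> \<union> {\<infinity>}\<close> are \<^typ>\<open>ereal\<close>-valued functions omitting \<open>-\<infinity>\<close>.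
  Since \<open>t\<close> is neither \<open>0\<close> nor \<open>1\<close>, no product of \<open>0\<close> and \<open>\<infinity>\<close> arises.\<close>

definition strongly_convex_on ::
    "real \<Rightarrow> 'a::real_normed_vector set \<Rightarrow> ('a \<Rightarrow> ereal) \<Rightarrow> bool" where
  "strongly_convex_on m S f \<longleftrightarrow> convex S \<and>
     (\<forall>x\<in>S. \<forall>y\<in>S. \<forall>t. 0 < t \<and> t < 1 \<longrightarrow>
        f ((1 - t) *\<^sub>R x + t *\<^sub>R y) + ereal (m / 2 * t * (1 - t) * (norm (x - y))\<^sup>2)
          \<le> ereal (1 - t) * f x + ereal t * f y)"

text \<open>The events below (for instance Lipschitz continuity of a random map) need not be measurable,
  so their probability is read as inner probability. For measurable events this is the
  ordinary probability, as \<open>with_high_prob_iff\<close> shows.\<close>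

definition with_high_prob :: "'w measure \<Rightarrow> (nat \<Rightarrow> 'w \<Rightarrow> bool) \<Rightarrow> bool" where
  "with_high_prob P E \<longleftrightarrow> (\<forall>\<epsilon>>0. \<forall>\<^sub>F n in sequentially.
     \<exists>A\<in>sets P. A \<subseteq> {\<omega>\<in>space P. E n \<omega>} \<and> measure P A \<ge> 1 - \<epsilon>)"

lemma with_high_prob_iff:
  assumes "prob_space P" and "\<And>n. {\<omega>\<in>space P. E n \<omega>} \<in> sets P"
  shows "with_high_prob P E \<longleftrightarrow>
    (\<forall>\<epsilon>>0. \<forall>\<^sub>F n in sequentially. measure P {\<omega>\<in>space P. E n \<omega>} \<ge> 1 - \<epsilon>)"
proof -
  interpret prob_space P by fact
  have "(\<exists>A\<in>sets P. A \<subseteq> {\<omega>\<in>space P. E n \<omega>} \<and> measure P A \<ge> 1 - \<epsilon>) \<longleftrightarrow>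
      measure P {\<omega>\<in>space P. E n \<omega>} \<ge> 1 - \<epsilon>" for n and \<epsilon> :: real
    using assms(2)[of n] finite_measure_mono[OF _ assms(2)[of n]]
    by (metis (no_types, lifting) order_trans order_refl)
  then show ?thesis
    unfolding with_high_prob_def by simp
qed

definition bounded_in_prob ::
    "'w measure \<Rightarrow> (nat \<Rightarrow> 'w \<Rightarrow> 'a::real_normed_vector) \<Rightarrow> bool" where
  "bounded_in_prob P X \<longleftrightarrow> (\<forall>\<epsilon>>0. \<exists>B. \<forall>\<^sub>F n in sequentially.
     measure P {\<omega>\<in>space P. norm (X n \<omega>) > B} < \<epsilon>)"

definition null_in_prob ::
    "'w measure \<Rightarrow> (nat \<Rightarrow> 'w \<Rightarrow> 'a::real_normed_vector) \<Rightarrow> bool" where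
  "null_in_prob P X \<longleftrightarrow>
     (\<forall>\<epsilon>>0. (\<lambda>n. measure P {\<omega>\<in>space P. norm (X n \<omega>) > \<epsilon>}) \<longlonglongrightarrow> 0)"

definition root_n_consistent ::
    "'w measure \<Rightarrow> (nat \<Rightarrow> 'w \<Rightarrow> 'a::real_normed_vector) \<Rightarrow> (nat \<Rightarrow> 'w \<Rightarrow> 'a) \<Rightarrow> bool" where
  "root_n_consistent P T' T \<longleftrightarrow>
     bounded_in_prob P (\<lambda>n \<omega>. sqrt (real n) *\<^sub>R (T' n \<omega> - T n \<omega>))"

definition asymptotically_equivalent ::
    "'w measure \<Rightarrow> (nat \<Rightarrow> 'w \<Rightarrow> 'a::real_normed_vector) \<Rightarrow> (nat \<Rightarrow> 'w \<Rightarrow> 'a) \<Rightarrow> bool" where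
  "asymptotically_equivalent P T T' \<longleftrightarrow>
     null_in_prob P (\<lambda>n \<omega>. sqrt (real n) * norm (T n \<omega> - T' n \<omega>))"

end

theory Submission
  imports Defs
begin

text \<open>Outside an event of small probability, write \<open>a\<close> for the minimizer of \<open>f\<close>, \<open>x\<close> for the initial
  estimator and \<open>b\<close> for its proximal point. The penalty vanishes at its centre, so \<open>a\<close> is a fixed
  point of the proximal operator, and Lipschitz continuity gives \<open>norm (b - a) \<le> L * norm (x - a)\<close>.
  This bound alone does not make \<open>b\<close> close enough to \<open>a\<close>; its role is to place \<open>b\<close> in a
  ball of radius \<open>M / sqrt n\<close> around \<open>a\<close>, where \<open>f\<close> is strongly convex. There \<open>f\<close> grows
  quadratically away from its minimizer, and comparing the values of the proximal objective at
  \<open>b\<close> and at \<open>a\<close> gives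
  \<open>m / 4 * (norm (b - a))\<^sup>2 \<le> f b - f a \<le> 1 / 2 * sq_norm_wrt C (a - x)
  \<le> 1 / 2 * lambda_max C * (norm (x - a))\<^sup>2\<close>.
  Multiplying by \<open>n\<close>, the right-hand side is a product of a term that tends to zero in probability
  and one that is bounded in probability. The deterministic part is
  \<open>prox_near_minimizer\<close>.

  The eigenvalue enters only through \<open>lambda_max_le_iff\<close>, the Rayleigh quotient
  characterization of \<open>lambda_max\<close>. It also shows that the events
  \<open>lambda_max (C n \<omega>) > \<eta>\<close> are measurable; this matters because \<^const>\<open>measure\<close> assigns \<open>0\<close>
  to non-measurable sets, so that a bound on it would otherwise say nothing about them.\<close>

section \<open>The largest eigenvalue of a symmetric matrix\<close>

lemma inner_matrix_vector_symmetric: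
  fixes C :: "real^'d^'d"
  assumes "transpose C = C"
  shows "u \<bullet> (C *v v) = (C *v u) \<bullet> v"
  by (metis assms dot_lmul_matrix transpose_matrix_vector)

text \<open>Eigenvectors for distinct eigenvalues are orthogonal, and a finite-dimensional space has no
  infinite orthogonal family of nonzero vectors.\<close>

lemma finite_eigenvalues_symmetric:
  fixes C :: "real^'d^'d"
  assumes sym: "transpose C = C"
  shows "finite {k. \<exists>v. v \<noteq> 0 \<and> C *v v = k *\<^sub>R v}" (is "finite ?K")
proof -
  define e where "e k = (SOME v. v \<noteq> 0 \<and> C *v v = k *\<^sub>R v)" for k
  have e: "e k \<noteq> 0 \<and> C *v e k = k *\<^sub>R e k" if "k \<in> ?K" for k
    using that unfolding e_def mem_Collect_eq by (rule someI_ex)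
  have orth: "e k \<bullet> e l = 0" if "k \<in> ?K" "l \<in> ?K" "k \<noteq> l" for k l
  proof -
    have "l * (e k \<bullet> e l) = k * (e k \<bullet> e l)"
      using inner_matrix_vector_symmetric[OF sym, of "e k" "e l"] e[OF that(1)] e[OF that(2)] by simp
    then show ?thesis using that(3) by simp
  qed
  have "inj_on e ?K"
  proof (rule inj_onI)
    fix k l assume kl: "k \<in> ?K" "l \<in> ?K" "e k = e l"
    show "k = l"
    proof (rule ccontr)
      assume "k \<noteq> l"
      from orth[OF kl(1,2) this] kl(3) have "e l = 0" by simp
      then show False using e[OF kl(2)] by simp
    qed
  qed
  moreover have "finite (e ` ?K)"
  proof (rule independent_imp_finite[OF pairwise_orthogonal_independent])
    show "pairwise orthogonal (e ` ?K)"
      using orth by (auto simp: pairwise_def orthogonal_def simp del: mem_Collect_eq)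
    show "0 \<notin> e ` ?K" using e by force
  qed
  ultimately show ?thesis using finite_imageD by blast
qed

text \<open>The maximum of the quadratic form over the unit sphere is attained, by compactness. A maximizer
  is an eigenvector, because the form \<open>k * (u \<bullet> u) - u \<bullet> (C *v u)\<close> is nonnegative
  and vanishes there, so its gradient vanishes too.\<close>

lemma Rayleigh_maximizer_exists:
  fixes C :: "real^'d^'d"
  assumes sym: "transpose C = C"
  obtains k v where "v \<noteq> 0" "C *v v = k *\<^sub>R v" "\<And>u. u \<bullet> (C *v u) \<le> k * (norm u)\<^sup>2"
proof -
  have "continuous_on (sphere 0 1) (\<lambda>u. u \<bullet> (C *v u))"
    by (intro continuous_intros linear_continuous_on matrix_vector_mul_bounded_linear)
  moreover have "sphere (0::real^'d) 1 \<noteq> {}" by simp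
  ultimately obtain v where v: "norm v = 1"
    and vmax: "\<And>u. norm u = 1 \<Longrightarrow> u \<bullet> (C *v u) \<le> v \<bullet> (C *v v)"
    using continuous_attains_sup[OF compact_sphere, of 0 1 "\<lambda>u. u \<bullet> (C *v u)"]
    by (auto simp: Ball_def)
  define k where "k = v \<bullet> (C *v v)"
  have le: "u \<bullet> (C *v u) \<le> k * (norm u)\<^sup>2" for u
  proof (cases "u = 0")
    case False
    define w where "w = (1 / norm u) *\<^sub>R u"
    have u: "u = norm u *\<^sub>R w" and "norm w = 1"
      using False by (auto simp: w_def)
    have "u \<bullet> (C *v u) = (norm u)\<^sup>2 * (w \<bullet> (C *v w))"
      by (subst (1 2) u) (simp add: matrix_vector_mult_scaleR power2_eq_square)
    also have "\<dots> \<le> (norm u)\<^sup>2 * k"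
      using vmax[OF \<open>norm w = 1\<close>] by (simp add: k_def mult_left_mono)
    finally show ?thesis by (simp add: mult.commute)
  qed simp
  define g where "g = k *\<^sub>R v - C *v v"
  have "g \<bullet> g = 0"
  proof (rule ccontr)
    assume "g \<bullet> g \<noteq> 0"
    then have pos: "g \<bullet> g > 0" by simp
    \<comment> \<open>Along \<open>v - t *\<^sub>R g\<close> the form is at most \<open>- 2 * t * (g \<bullet> g) + t\<^sup>2 * B\<close>, which is least at this \<open>t\<close>.\<close>
    define B where "B = \<bar>k * (g \<bullet> g) - g \<bullet> (C *v g)\<bar> + 1"
    define t where "t = (g \<bullet> g) / B"
    have "B > 0" by (simp add: B_def)
    have "0 \<le> k * (norm (v - t *\<^sub>R g))\<^sup>2 - (v - t *\<^sub>R g) \<bullet> (C *v (v - t *\<^sub>R g))"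
      using le by simp
    also have "\<dots> = k * (v \<bullet> v) - v \<bullet> (C *v v) - 2 * t * (g \<bullet> g)
        + t\<^sup>2 * (k * (g \<bullet> g) - g \<bullet> (C *v g))"
    proof -
      have norm_expand: "(norm (v - t *\<^sub>R g))\<^sup>2 = v \<bullet> v - 2 * t * (v \<bullet> g) + t\<^sup>2 * (g \<bullet> g)"
        unfolding power2_norm_eq_inner
        by (simp add: inner_diff_left inner_diff_right inner_commute power2_eq_square)
      have form_expand: "(v - t *\<^sub>R g) \<bullet> (C *v (v - t *\<^sub>R g))
          = v \<bullet> (C *v v) - 2 * t * (g \<bullet> (C *v v)) + t\<^sup>2 * (g \<bullet> (C *v g))"
        using inner_matrix_vector_symmetric[OF sym, of v g]
        by (simp add: matrix_vector_mult_diff_distrib matrix_vector_mult_scaleR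
            inner_diff_left inner_diff_right inner_commute power2_eq_square algebra_simps)
      have "g \<bullet> g = k * (v \<bullet> g) - g \<bullet> (C *v v)"
        by (subst (2) g_def) (simp add: inner_diff_right inner_commute[of g v])
      then have "t * (g \<bullet> g) = t * (k * (v \<bullet> g)) - t * (g \<bullet> (C *v v))"
        by (simp only: right_diff_distrib)
      then show ?thesis
        unfolding norm_expand form_expand by (simp add: algebra_simps)
    qed
    also have "\<dots> = - 2 * t * (g \<bullet> g) + t\<^sup>2 * (k * (g \<bullet> g) - g \<bullet> (C *v g))"
      using v by (simp add: k_def flip: power2_norm_eq_inner)
    also have "\<dots> \<le> - 2 * t * (g \<bullet> g) + t\<^sup>2 * B"
      by (intro add_left_mono mult_left_mono) (auto simp: B_def)
    also have "\<dots> = - ((g \<bullet> g)\<^sup>2 / B)"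
      using \<open>B > 0\<close> by (simp add: t_def power2_eq_square field_simps)
    also have "\<dots> < 0" using pos \<open>B > 0\<close> by simp
    finally show False by simp
  qed
  then have "C *v v = k *\<^sub>R v" by (simp add: g_def)
  moreover have "v \<noteq> 0" using v by auto
  ultimately show thesis using le that by blast
qed

lemma lambda_max_le_iff:
  fixes C :: "real^'d^'d"
  assumes sym: "transpose C = C"
  shows "lambda_max C \<le> c \<longleftrightarrow> (\<forall>u. u \<bullet> (C *v u) \<le> c * (norm u)\<^sup>2)"
proof -
  let ?K = "{k. \<exists>v. v \<noteq> 0 \<and> C *v v = k *\<^sub>R v}"
  have fin: "finite ?K" by (rule finite_eigenvalues_symmetric[OF sym])
  obtain k v where k: "v \<noteq> 0" "C *v v = k *\<^sub>R v"
    and ray: "\<And>u. u \<bullet> (C *v u) \<le> k * (norm u)\<^sup>2"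
    using Rayleigh_maximizer_exists[OF sym] by blast
  have "k \<in> ?K" using k by blast
  then have Max: "lambda_max C \<le> c \<longleftrightarrow> (\<forall>l\<in>?K. l \<le> c)"
    unfolding lambda_max_def using fin by (subst Max_le_iff) auto
  show ?thesis
  proof
    assume "lambda_max C \<le> c"
    with Max \<open>k \<in> ?K\<close> have "k \<le> c" by blast
    then show "\<forall>u. u \<bullet> (C *v u) \<le> c * (norm u)\<^sup>2"
      using ray by (meson mult_right_mono order_trans zero_le_power2)
  next
    assume R: "\<forall>u. u \<bullet> (C *v u) \<le> c * (norm u)\<^sup>2"
    have "l \<le> c" if "l \<in> ?K" for l
    proof -
      from that obtain w where w: "w \<noteq> 0" "C *v w = l *\<^sub>R w" by blast
      with R have "l * (norm w)\<^sup>2 \<le> c * (norm w)\<^sup>2"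
        by (metis inner_scaleR_right power2_norm_eq_inner)
      then show ?thesis using w(1) by simp
    qed
    then show "lambda_max C \<le> c" using Max by blast
  qed
qed

lemma sq_norm_wrt_le_lambda_max:
  fixes C :: "real^'d^'d"
  assumes "transpose C = C"
  shows "sq_norm_wrt C u \<le> lambda_max C * (norm u)\<^sup>2"
  using lambda_max_le_iff[OF assms] unfolding sq_norm_wrt_def by blast

lemma sq_norm_wrt_nonneg:
  assumes "positive_definite C"
  shows "0 \<le> sq_norm_wrt C u"
  using assms by (cases "u = 0") (auto simp: positive_definite_def sq_norm_wrt_def less_imp_le)

text \<open>By the Rayleigh quotient, a sublevel set of \<open>lambda_max\<close> among symmetric matrices is cut out by
  linear inequalities in the matrix, one for each vector \<open>u\<close>, and is therefore closed.\<close>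

lemma lambda_max_measurable:
  fixes C :: "'w \<Rightarrow> real^'d^'d"
  assumes meas: "C \<in> borel_measurable P"
    and sym: "\<And>\<omega>. \<omega> \<in> space P \<Longrightarrow> transpose (C \<omega>) = C \<omega>"
  shows "(\<lambda>\<omega>. lambda_max (C \<omega>)) \<in> borel_measurable P"
  unfolding borel_measurable_iff_le
proof
  fix c
  let ?S = "\<Inter>u. {A :: real^'d^'d. u \<bullet> (A *v u) \<le> c * (norm u)\<^sup>2}"
  have "continuous_on UNIV (\<lambda>A :: real^'d^'d. u \<bullet> (A *v u))" for u
    unfolding matrix_vector_mult_def inner_vec_def by (intro continuous_intros)
  then have "closed ?S"
    by (intro closed_INT ballI closed_Collect_le continuous_on_const) auto
  then have "C -` ?S \<inter> space P \<in> sets P"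
    using meas by (intro measurable_sets[of _ _ borel]) auto
  also have "C -` ?S \<inter> space P = {\<omega>\<in>space P. lambda_max (C \<omega>) \<le> c}"
    using lambda_max_le_iff[OF sym] by auto
  finally show "{\<omega>\<in>space P. lambda_max (C \<omega>) \<le> c} \<in> sets P" .
qed

section \<open>Proximal points of a strongly convex function\<close>

lemma argmin_iff: "w \<in> argmin f \<longleftrightarrow> (\<forall>y. f w \<le> f y)"
  unfolding argmin_def is_arg_min_def by (auto simp: not_less)

text \<open>Both summands of the proximal objective are minimal at a minimizer of \<open>f\<close>.\<close>

lemma minimizer_fixed_by_prox:
  assumes "positive_definite C" and "a \<in> argmin f"
  shows "a \<in> scaled_prox C f a"
proof -
  have "f a + ereal (1 / 2 * sq_norm_wrt C (a - a)) \<le> f w + ereal (1 / 2 * sq_norm_wrt C (w - a))" for w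
  proof (rule add_mono)
    show "f a \<le> f w" using assms(2) by (simp add: argmin_iff)
    have "sq_norm_wrt C (a - a) = 0" by (simp add: sq_norm_wrt_def)
    then show "ereal (1 / 2 * sq_norm_wrt C (a - a)) \<le> ereal (1 / 2 * sq_norm_wrt C (w - a))"
      using sq_norm_wrt_nonneg[OF assms(1), of "w - a"] by simp
  qed
  then show ?thesis unfolding scaled_prox_def argmin_iff by blast
qed

text \<open>An identically infinite \<open>f\<close> would make every point a proximal point.\<close>

lemma unique_prox_imp_finite_minimum:
  fixes f :: "real^'d \<Rightarrow> ereal"
  assumes "scaled_prox C f x = {p}" and "a \<in> argmin f"
  shows "f a \<noteq> \<infinity>"
proof
  assume "f a = \<infinity>"
  then have "f w = \<infinity>" for w using assms(2) by (metis argmin_iff ereal_infty_less_eq(1))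
  then have "scaled_prox C f x = UNIV" unfolding scaled_prox_def by (auto simp: argmin_iff)
  with assms(1) have "(UNIV :: (real^'d) set) = {p}" by simp
  moreover have "p + 1 \<noteq> p" by simp
  ultimately show False by blast
qed

text \<open>Comparing \<open>f\<close> at the midpoint of \<open>a\<close> and \<open>b\<close> with its minimum gives the growth constant
  \<open>m / 4\<close>. Points of the segment tending to \<open>a\<close> would give \<open>m / 2\<close>, but a constant factor does not
  affect rates of convergence.\<close>

lemma strongly_convex_growth:
  assumes sc: "strongly_convex_on m S f" and S: "a \<in> S" "b \<in> S"
    and min: "a \<in> argmin f" and fin: "f a = ereal r" "f b = ereal s"
  shows "m / 4 * (norm (b - a))\<^sup>2 \<le> s - r"
proof -
  let ?z = "(1 - 1/2) *\<^sub>R a + (1/2 :: real) *\<^sub>R b"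
  have *: "\<forall>t. 0 < t \<and> t < 1 \<longrightarrow>
      f ((1 - t) *\<^sub>R a + t *\<^sub>R b) + ereal (m / 2 * t * (1 - t) * (norm (a - b))\<^sup>2)
      \<le> ereal (1 - t) * f a + ereal t * f b"
    using sc S unfolding strongly_convex_on_def by blast
  have "ereal r \<le> f ?z"
    using min fin(1) by (metis argmin_iff)
  then have "ereal r + ereal (m / 2 * (1/2) * (1 - 1/2) * (norm (a - b))\<^sup>2)
      \<le> f ?z + ereal (m / 2 * (1/2) * (1 - 1/2) * (norm (a - b))\<^sup>2)"
    by (rule add_right_mono)
  also have "\<dots> \<le> ereal (1 - 1/2) * f a + ereal (1/2) * f b"
    using *[rule_format, of "1/2"] by simp
  finally show ?thesis by (simp add: fin norm_minus_commute field_simps)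
qed

text \<open>The radius \<open>max 1 L * R\<close> makes the ball contain both \<open>x\<close> and its proximal point \<open>b\<close>; the latter
  by Lipschitz continuity, since \<open>a\<close> is its own proximal point.\<close>

lemma prox_near_minimizer:
  fixes f :: "real^'d \<Rightarrow> ereal"
  assumes C: "positive_definite C"
    and range: "\<And>w. f w \<noteq> -\<infinity>"
    and a: "a \<in> argmin f"
    and b: "b \<in> scaled_prox C f x"
    and x: "norm (x - a) \<le> R"
    and S: "S = {w. norm (w - a) \<le> max 1 L * R}"
    and lip: "single_valued_lipschitz_on L S (scaled_prox C f)"
    and sc: "strongly_convex_on m S f"
  shows "m * (norm (b - a))\<^sup>2 \<le> 2 * lambda_max C * (norm (x - a))\<^sup>2"
proof -
  obtain p where p: "\<And>w. w \<in> S \<Longrightarrow> scaled_prox C f w = {p w}" and L: "L-lipschitz_on S p"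
    using lip unfolding single_valued_lipschitz_on_def by blast
  have R: "0 \<le> R" using x norm_ge_zero order_trans by blast
  have "R \<le> max 1 L * R" using R mult_right_mono[of 1 "max 1 L" R] by simp
  then have aS: "a \<in> S" and xS: "x \<in> S"
    using R x by (auto simp: S)
  have pa: "p a = a" using p[OF aS] minimizer_fixed_by_prox[OF C a] by auto
  have px: "p x = b" using p[OF xS] b by auto
  have "norm (b - a) \<le> L * norm (x - a)"
    using lipschitz_onD[OF L xS aS] by (simp add: pa px dist_norm)
  also have "\<dots> \<le> max 1 L * R"
    using x lipschitz_on_nonneg[OF L] by (intro mult_mono) auto
  finally have bS: "b \<in> S" by (simp add: S)
  obtain r where r: "f a = ereal r"
    using range[of a] unique_prox_imp_finite_minimum[OF p[OF aS] a] by (cases "f a") auto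
  have le: "f b + ereal (1 / 2 * sq_norm_wrt C (b - x)) \<le> f a + ereal (1 / 2 * sq_norm_wrt C (a - x))"
    using b unfolding scaled_prox_def argmin_iff by blast
  obtain s where s: "f b = ereal s"
    using le range[of b] r by (cases "f b") auto
  have "m / 4 * (norm (b - a))\<^sup>2 \<le> s - r"
    by (rule strongly_convex_growth[OF sc aS bS a r s])
  also have "\<dots> \<le> 1 / 2 * sq_norm_wrt C (a - x)"
    using le sq_norm_wrt_nonneg[OF C, of "b - x"] by (simp add: r s)
  also have "\<dots> \<le> 1 / 2 * (lambda_max C * (norm (a - x))\<^sup>2)"
    using sq_norm_wrt_le_lambda_max[of C "a - x"] C by (simp add: positive_definite_def)
  finally show ?thesis by (simp add: norm_minus_commute)
qed

section \<open>Asymptotic equivalence\<close>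

lemma (in prob_space) prob_compl_le:
  assumes "A \<in> events" and "1 - \<epsilon> \<le> prob A"
  shows "prob (space M - A) \<le> \<epsilon>"
  using assms by (simp add: prob_compl)

theorem theorem3p1:
  fixes P :: "'w measure"
    and \<Theta> :: "(real^'d) set"
    and f :: "nat \<Rightarrow> 'w \<Rightarrow> real^'d \<Rightarrow> ereal"
    and C :: "nat \<Rightarrow> 'w \<Rightarrow> real^'d^'d"
    and \<theta>hat \<theta>init \<theta>ose :: "nat \<Rightarrow> 'w \<Rightarrow> real^'d"
  assumes "prob_space P"
    and "open \<Theta>"
    and f_random: "\<And>n \<theta>. \<theta> \<in> \<Theta> \<Longrightarrow> (\<lambda>\<omega>. f n \<omega> \<theta>) \<in> borel_measurable P"
    and f_range: "\<And>n \<omega> \<theta>. \<omega> \<in> space P \<Longrightarrow> f n \<omega> \<theta> \<noteq> -\<infinity>"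
    and f_outside: "\<And>n \<omega> \<theta>. \<omega> \<in> space P \<Longrightarrow> \<theta> \<notin> \<Theta> \<Longrightarrow> f n \<omega> \<theta> = \<infinity>"
    and C_random: "\<And>n. C n \<in> borel_measurable P"
    and C_posdef: "\<And>n \<omega>. \<omega> \<in> space P \<Longrightarrow> positive_definite (C n \<omega>)"
    and "\<And>n. \<theta>hat n \<in> borel_measurable P"
    and "\<And>n. \<theta>init n \<in> borel_measurable P"
    and "\<And>n. \<theta>ose n \<in> borel_measurable P"
    and hat_min: "\<And>n. AE \<omega> in P. \<theta>hat n \<omega> \<in> argmin (f n \<omega>)"
    and ose_prox: "\<And>n. AE \<omega> in P. \<theta>ose n \<omega> \<in> scaled_prox (C n \<omega>) (f n \<omega>) (\<theta>init n \<omega>)"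
    and i: "null_in_prob P (\<lambda>n \<omega>. lambda_max (C n \<omega>))"
    and ii: "\<exists>L. \<forall>M. with_high_prob P (\<lambda>n \<omega>.
        single_valued_lipschitz_on L {\<theta>. norm (\<theta> - \<theta>hat n \<omega>) \<le> M / sqrt (real n)}
          (scaled_prox (C n \<omega>) (f n \<omega>)))"
    and iii: "\<exists>m>0. \<forall>M. with_high_prob P (\<lambda>n \<omega>.
        strongly_convex_on m {\<theta>. norm (\<theta> - \<theta>hat n \<omega>) \<le> M / sqrt (real n)} (f n \<omega>))"
    and init: "root_n_consistent P \<theta>init \<theta>hat"
  shows "asymptotically_equivalent P \<theta>hat \<theta>ose"
proof -
  interpret prob_space P by fact
  note [measurable] = \<open>\<And>n. \<theta>hat n \<in> borel_measurable P\<close> \<open>\<And>n. \<theta>init n \<in> borel_measurable P\<close>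
  have [measurable]: "(\<lambda>\<omega>. lambda_max (C n \<omega>)) \<in> borel_measurable P" for n
    using C_posdef by (intro lambda_max_measurable C_random) (simp add: positive_definite_def)
  obtain L where L: "\<And>M. with_high_prob P (\<lambda>n \<omega>.
        single_valued_lipschitz_on L {\<theta>. norm (\<theta> - \<theta>hat n \<omega>) \<le> M / sqrt (real n)}
          (scaled_prox (C n \<omega>) (f n \<omega>)))"
    using ii by blast
  obtain m where "m > 0" and m: "\<And>M. with_high_prob P (\<lambda>n \<omega>.
        strongly_convex_on m {\<theta>. norm (\<theta> - \<theta>hat n \<omega>) \<le> M / sqrt (real n)} (f n \<omega>))"
    using iii by blast
  let ?Q = "\<lambda>\<epsilon> n. {\<omega>\<in>space P. norm (sqrt (real n) * norm (\<theta>hat n \<omega> - \<theta>ose n \<omega>)) > \<epsilon>}"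
  have main: "\<forall>\<^sub>F n in sequentially. prob (?Q \<epsilon> n) < \<delta>" if \<epsilon>: "\<epsilon> > 0" and \<delta>: "\<delta> > 0" for \<epsilon> \<delta>
  proof -
    obtain K0 where K0: "\<forall>\<^sub>F n in sequentially.
        prob {\<omega>\<in>space P. norm (sqrt (real n) *\<^sub>R (\<theta>init n \<omega> - \<theta>hat n \<omega>)) > K0} < \<delta> / 4"
      using init \<delta> unfolding root_n_consistent_def bounded_in_prob_def
      by (meson divide_pos_pos zero_less_numeral)
    define K where "K = max 1 K0"
    have "K > 0" by (simp add: K_def)
    define M where "M = max 1 L * K"
    \<comment> \<open>The threshold is chosen so that \<open>2 * \<eta> / m * K\<^sup>2 = \<epsilon>\<^sup>2\<close>.\<close>
    define \<eta> where "\<eta> = m * \<epsilon>\<^sup>2 / (2 * K\<^sup>2)"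
    have "\<eta> > 0" using \<open>m > 0\<close> \<open>K > 0\<close> \<epsilon> by (simp add: \<eta>_def)
    have ev_lam: "\<forall>\<^sub>F n in sequentially. prob {\<omega>\<in>space P. norm (lambda_max (C n \<omega>)) > \<eta>} < \<delta> / 4"
      using i \<open>\<eta> > 0\<close> \<delta> unfolding null_in_prob_def by (intro order_tendstoD) auto
    have ev_lip: "\<forall>\<^sub>F n in sequentially. \<exists>A\<in>events. A \<subseteq> {\<omega>\<in>space P.
        single_valued_lipschitz_on L {\<theta>. norm (\<theta> - \<theta>hat n \<omega>) \<le> M / sqrt (real n)}
          (scaled_prox (C n \<omega>) (f n \<omega>))} \<and> prob A \<ge> 1 - \<delta> / 4"
      using L[of M] \<delta> unfolding with_high_prob_def by simp
    have ev_sc: "\<forall>\<^sub>F n in sequentially. \<exists>A\<in>events. A \<subseteq> {\<omega>\<in>space P.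
        strongly_convex_on m {\<theta>. norm (\<theta> - \<theta>hat n \<omega>) \<le> M / sqrt (real n)} (f n \<omega>)}
          \<and> prob A \<ge> 1 - \<delta> / 4"
      using m[of M] \<delta> unfolding with_high_prob_def by simp
    show ?thesis
      using K0 ev_lam ev_lip ev_sc eventually_gt_at_top[of 0]
    proof eventually_elim
      case (elim n)
      let ?s = "sqrt (real n)"
      have s: "?s > 0" using elim(5) by simp
      obtain A where A: "A \<in> events" "prob A \<ge> 1 - \<delta> / 4"
        and Alip: "\<And>\<omega>. \<omega> \<in> A \<Longrightarrow> single_valued_lipschitz_on L
          {\<theta>. norm (\<theta> - \<theta>hat n \<omega>) \<le> M / ?s} (scaled_prox (C n \<omega>) (f n \<omega>))"
        using elim(3) by blast
      obtain B where B: "B \<in> events" "prob B \<ge> 1 - \<delta> / 4"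
        and Bsc: "\<And>\<omega>. \<omega> \<in> B \<Longrightarrow> strongly_convex_on m
          {\<theta>. norm (\<theta> - \<theta>hat n \<omega>) \<le> M / ?s} (f n \<omega>)"
        using elim(4) by blast
      define U where "U = {\<omega>\<in>space P. norm (?s *\<^sub>R (\<theta>init n \<omega> - \<theta>hat n \<omega>)) > K0}"
      define V where "V = {\<omega>\<in>space P. norm (lambda_max (C n \<omega>)) > \<eta>}"
      have U: "U \<in> events" unfolding U_def by measurable
      have V: "V \<in> events" unfolding V_def by measurable
      have "AE \<omega> in P. \<omega> \<in> ?Q \<epsilon> n \<longrightarrow> \<omega> \<in> (space P - A) \<union> (space P - B) \<union> U \<union> V"
        using hat_min[of n] ose_prox[of n]
      proof eventually_elim
        case (elim \<omega>)
        show ?case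
        proof (rule impI, rule ccontr)
          assume Q: "\<omega> \<in> ?Q \<epsilon> n" and "\<omega> \<notin> (space P - A) \<union> (space P - B) \<union> U \<union> V"
          then have \<omega>: "\<omega> \<in> space P" "\<omega> \<in> A" "\<omega> \<in> B"
            and sx: "?s * norm (\<theta>init n \<omega> - \<theta>hat n \<omega>) \<le> K"
            and lam: "lambda_max (C n \<omega>) \<le> \<eta>"
            by (auto simp: U_def V_def K_def)
          have x: "norm (\<theta>init n \<omega> - \<theta>hat n \<omega>) \<le> K / ?s"
            using sx s by (simp add: field_simps)
          have "m * (norm (\<theta>ose n \<omega> - \<theta>hat n \<omega>))\<^sup>2
              \<le> 2 * lambda_max (C n \<omega>) * (norm (\<theta>init n \<omega> - \<theta>hat n \<omega>))\<^sup>2"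
            by (rule prox_near_minimizer[OF C_posdef[OF \<omega>(1)] f_range[OF \<omega>(1)] elim x _
                  Alip[OF \<omega>(2)] Bsc[OF \<omega>(3)]]) (simp add: M_def)
          also have "\<dots> \<le> 2 * \<eta> * (norm (\<theta>init n \<omega> - \<theta>hat n \<omega>))\<^sup>2"
            using lam by (intro mult_right_mono) auto
          finally have "?s\<^sup>2 * (m * (norm (\<theta>ose n \<omega> - \<theta>hat n \<omega>))\<^sup>2)
              \<le> ?s\<^sup>2 * (2 * \<eta> * (norm (\<theta>init n \<omega> - \<theta>hat n \<omega>))\<^sup>2)"
            by (rule mult_left_mono) simp
          then have "m * (?s * norm (\<theta>ose n \<omega> - \<theta>hat n \<omega>))\<^sup>2
              \<le> 2 * \<eta> * (?s * norm (\<theta>init n \<omega> - \<theta>hat n \<omega>))\<^sup>2"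
            by (simp only: power_mult_distrib mult_ac)
          also have "\<dots> \<le> 2 * \<eta> * K\<^sup>2"
            using sx \<open>\<eta> > 0\<close> by (intro mult_left_mono power_mono) auto
          also have "\<dots> = m * \<epsilon>\<^sup>2" using \<open>K > 0\<close> by (simp add: \<eta>_def)
          finally have "(?s * norm (\<theta>ose n \<omega> - \<theta>hat n \<omega>))\<^sup>2 \<le> \<epsilon>\<^sup>2"
            using \<open>m > 0\<close> by simp
          then have "?s * norm (\<theta>ose n \<omega> - \<theta>hat n \<omega>) \<le> \<epsilon>"
            by (rule power2_le_imp_le) (use \<epsilon> in simp)
          with Q show False by (simp add: norm_minus_commute abs_mult)
        qed
      qed
      then have "prob (?Q \<epsilon> n) \<le> prob ((space P - A) \<union> (space P - B) \<union> U \<union> V)"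
        using A B U V by (intro finite_measure_mono_AE) auto
      also have "\<dots> \<le> prob (space P - A) + prob (space P - B) + prob U + prob V"
        using A B U V
        by (intro order_trans[OF measure_Un_le] add_mono order_refl) auto
      also have "\<dots> < \<delta> / 4 + \<delta> / 4 + \<delta> / 4 + \<delta> / 4"
        using prob_compl_le[OF A] prob_compl_le[OF B] elim(1,2)
        unfolding U_def V_def by linarith
      finally show ?case by simp
    qed
  qed
  have "(\<lambda>n. prob (?Q \<epsilon> n)) \<longlonglongrightarrow> 0" if "\<epsilon> > 0" for \<epsilon>
  proof (rule order_tendstoI)
    fix y :: real assume "y < 0"
    then show "\<forall>\<^sub>F n in sequentially. y < prob (?Q \<epsilon> n)"
      by (intro always_eventually allI) (meson measure_nonneg order_less_le_trans)
  qed (rule main[OF that])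
  then show ?thesis
    unfolding asymptotically_equivalent_def null_in_prob_def by blast
qed

end
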